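(* Let $f(z)=z+1+e^{-z}$ and $g(z)=f(z)+2\pi i$ for $z\in\mathbb{C}$ (these functions commute: $f\circ g=g\circ f$). Then $g(I(f))\subset I(f)$ and $f(I(g))\subset I(g)$.
   Context: For an entire function $h$, $h^n$ denotes the $n$-th iterate of $h$, and the escaping set of $h$ is $I(h)=\{z\in\mathbb{C}: h^n(z)\to\infty \text{ as } n\to\infty\}$. *)

theory Defs
  imports Complex_Main
begin

definition escaping_set :: "(complex \<Rightarrow> complex) \<Rightarrow> complex set" where
  "escaping_set h = {z. filterlim (\<lambda>n. (h ^^ n) z) at_infinity sequentially}"

end

theory Submission
  imports Defs
begin

text \<open>
  Since \<open>exp\<close> has period \<open>2 * pi * \<i>\<close>, both \<open>f\<close> and \<open>g\<close> commute with the translation by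
  \<open>c = 2 * pi * \<i>\<close>, and hence with its inverse.  This gives \<open>f \<circ> g = g \<circ> f\<close>.  It also means
  that each map is the other followed by a translation commuting with it.  If \<open>h\<close> commutes with
  the translation by \<open>d\<close>, the \<open>h\<close>-orbit of \<open>h z + d\<close> is the orbit of \<open>z\<close> shifted by one time step
  in the index and by the constant \<open>d\<close> in the plane, so it escapes whenever the orbit of \<open>z\<close> does
  (lemma \<open>translate_image_in_escaping_set\<close>).  The two inclusions are the cases \<open>h = f\<close>, \<open>d = c\<close>
  and \<open>h = g\<close>, \<open>d = - c\<close>.
\<close>

lemma funpow_commutes_with_translation:
  fixes h :: "'a :: plus \<Rightarrow> 'a"
  assumes "\<And>z. h (z + d) = h z + d"
  shows "(h ^^ n) (z + d) = (h ^^ n) z + d"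
  by (induction n) (simp_all add: assms)

text \<open>
  The iterates satisfy \<open>h\<^sup>n(h z + d) = h\<^sup>n\<^sup>+\<^sup>1(z) + d\<close>, and neither dropping the first term of a
  sequence nor adding a constant to it affects convergence to infinity.
\<close>

lemma translate_image_in_escaping_set:
  assumes comm: "\<And>z. h (z + d) = h z + d" and z: "z \<in> escaping_set h"
  shows "h z + d \<in> escaping_set h"
proof -
  have "filterlim (\<lambda>n. (h ^^ Suc n) z) at_infinity sequentially"
    using z unfolding escaping_set_def mem_Collect_eq
    by (rule filterlim_compose[OF _ filterlim_Suc])
  then have "filterlim (\<lambda>n. (h ^^ Suc n) z + d) at_infinity sequentially"
    by (rule tendsto_add_filterlim_at_infinity'[OF _ tendsto_const])
  moreover have "(h ^^ n) (h z + d) = (h ^^ Suc n) z + d" for n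
    by (simp only: funpow_commutes_with_translation[of h d, OF comm] funpow_Suc_right o_apply)
  ultimately show ?thesis
    by (simp add: escaping_set_def)
qed

theorem proposition3p2:
  fixes f g :: "complex \<Rightarrow> complex"
  assumes "f = (\<lambda>z. z + 1 + exp (- z))"
    and "g = (\<lambda>z. f z + 2 * complex_of_real pi * \<i>)"
  shows "f \<circ> g = g \<circ> f
    \<and> g ` escaping_set f \<subseteq> escaping_set f
    \<and> f ` escaping_set g \<subseteq> escaping_set g"
proof -
  define c where "c = 2 * complex_of_real pi * \<i>"
  have g: "g z = f z + c" for z
    by (simp add: assms(2) c_def)
  have "exp c = 1"
    by (simp add: c_def exp_eq_polar)
  then have f_comm: "f (z + c) = f z + c" for z
    by (simp add: assms(1) exp_diff exp_minus exp_add)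
  have g_comm: "g (z + (- c)) = g z + (- c)" for z
    using f_comm[of "z - c"] by (simp add: g)
  have "f \<circ> g = g \<circ> f"
    by (simp add: fun_eq_iff g f_comm)
  moreover have "g z \<in> escaping_set f" if "z \<in> escaping_set f" for z
    using translate_image_in_escaping_set[of f c, OF f_comm that] by (simp add: g)
  moreover have "f z \<in> escaping_set g" if "z \<in> escaping_set g" for z
    using translate_image_in_escaping_set[of g "- c", OF g_comm that] by (simp add: g)
  ultimately show ?thesis
    by blast
qed

end
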